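(* Let $T:\mathbb{E}\rightrightarrows\mathbb{E}$ be a union upper semicontinuous operator (with sets $\mathcal{D}=\{D_\iota:\iota\in\mathcal{I}\}$ and individual operators $T_\iota$) for which there exists a Lyapunov function. Let $\{w^k\}$ be a sequence generated by $w^{k+1}\in T(w^k)$, $k\ge0$, with an accumulation point $w^*$, and suppose that for each $\iota\in\phi_{\mathcal{D}}(w^* )$, $T_\iota$ is calm at $w^*$ with parameter $\kappa_\iota\in[0,1]$. If $T$ is single-valued at $w^*$, then $w^k\to w^*$ and $\phi_{\mathcal{D}}(w^k)\subset\phi_{\mathcal{D}}(w^* )$ for all sufficiently large $k$. Moreover, the rate of convergence is locally $Q$-linear if $\kappa_\iota<1$ for all $\iota\in\phi_{\mathcal{D}}(w^* )$.
   Context: $\mathbb{E}$ is a Euclidean space with norm $\|\cdot\|$; $B(0,1)$ is the open unit ball. For $T:\mathbb{E}\rightrightarrows\mathbb{E}$, $\mathrm{Fix}(T)=\{w\in\mathbb{E}: w\in T(w)\}$. Upper semicontinuity: given $X\subset\mathbb{E}$, a set-valued map $S$ on $X$ and $w\in X$ with $S(w)\ne\emptyset$, $S$ is upper semicontinuous (usc) at $w$ if for any neighborhood $\mathcal{U}$ of $S(w)$ there exists $\delta>0$ such that $S(z)\subseteq\mathcal{U}$ for all $z\in X$ with $\|z-w\|<\delta$. $S$ is usc on $X$ if it is usc at each point of $X$. Union upper semicontinuity: $T:\mathbb{E}\rightrightarrows\mathbb{E}$ is union upper semicontinuous if there exist a finite index set $\mathcal{I}$, a collection $\mathcal{D}=\{D_\iota:\iota\in\mathcal{I}\}$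 of nonempty closed subsets of $\mathbb{E}$ with $\mathbb{E}=\bigcup_{\iota\in\mathcal{I}}D_\iota$, and upper semicontinuous operators $T_\iota:D_\iota\rightrightarrows\mathbb{E}$ (the individual operators) such that $T_\iota(w)$ is nonempty and compact for every $w\in D_\iota$, and $T(w)=\bigcup_{\iota\in\mathcal{I}:\,w\in D_\iota}T_\iota(w)$ for all $w\in\mathbb{E}$. For $w\in\mathbb{E}$, $\phi_{\mathcal{D}}(w)=\{\iota\in\mathcal{I}: w\in D_\iota\}$. Lyapunov function: a function $V:\mathbb{E}\to\mathbb{R}\cup\{+\infty\}$, continuous in its domain $\{w: V(w)<+\infty\}$, is a Lyapunov function for $T$ if $\inf V>-\infty$, $\sup_{w^+\in T(w)}V(w^+)\le V(w)$ for all $w\in\mathbb{E}$, and $w\in\mathrm{Fix}(T)$ whenever equality holds in this inequality. Calmness: $T_\iota$ is calm at $w\in D_\iota$ with parameter $\kappa\ge0$ if $T_\iota(w)\neq\emptyset$ and there is a neighborhood $\mathcal{U}$ of $w$ such that $T_\iota(z)\subset T_\iota(w)+\kappa\|z-w\|B(0,1)$ for all $z\in\mathcal{U}\cap D_\iota$. Locally $Q$-linear convergence to $w^*$ means there is $\kappa\in[0,1)$ with $\|w^{k+1}-w^*\|\le\kappa\|w^k-w^*\|$ for all sufficiently large $k$.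
   Formalization: "Continuous in its domain" is strengthened: the Lyapunov function V must also tend to +∞ at points with V=+∞ approached through its domain (V is lower semicontinuous); with continuity relative to the domain alone the claim fails. *)

theory Defs
  imports "HOL-Analysis.Analysis"
begin

text \<open>A set-valued map on a set \<open>X\<close> is a total function \<open>S :: 'a \<Rightarrow> 'b set\<close> of which only
  the values on \<open>X\<close> matter.\<close>

definition Fix :: "('a \<Rightarrow> 'a set) \<Rightarrow> 'a set" where
  "Fix T = {w. w \<in> T w}"

definition usc_at ::
  "'a::real_normed_vector set \<Rightarrow> ('a \<Rightarrow> 'b::topological_space set) \<Rightarrow> 'a \<Rightarrow> bool" where
  "usc_at X S w \<longleftrightarrow> w \<in> X \<and> S w \<noteq> {} \<and>
     (\<forall>U. S w \<subseteq> interior U \<longrightarrow> (\<exists>\<delta>>0. \<forall>z\<in>X. norm (z - w) < \<delta> \<longrightarrow> S z \<subseteq> U))"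

definition usc_on ::
  "'a::real_normed_vector set \<Rightarrow> ('a \<Rightarrow> 'b::topological_space set) \<Rightarrow> bool" where
  "usc_on X S \<longleftrightarrow> (\<forall>w\<in>X. usc_at X S w)"

definition active_indices :: "'i set \<Rightarrow> ('i \<Rightarrow> 'a set) \<Rightarrow> 'a \<Rightarrow> 'i set" where
  "active_indices I D w = {i \<in> I. w \<in> D i}"

text \<open>\<open>T\<close> is union upper semicontinuous, as witnessed by the sets \<open>D i\<close> and the individual
  operators \<open>S i\<close> on \<open>D i\<close>, for \<open>i \<in> I\<close>.\<close>

definition union_usc ::
  "'i set \<Rightarrow> ('i \<Rightarrow> 'a::euclidean_space set) \<Rightarrow> ('i \<Rightarrow> 'a \<Rightarrow> 'a set) \<Rightarrow> ('a \<Rightarrow> 'a set) \<Rightarrow> bool"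
where
  "union_usc I D S T \<longleftrightarrow>
     finite I \<and>
     (\<forall>i\<in>I. D i \<noteq> {} \<and> closed (D i)) \<and>
     (\<Union>i\<in>I. D i) = UNIV \<and>
     (\<forall>i\<in>I. usc_on (D i) (S i)) \<and>
     (\<forall>i\<in>I. \<forall>w\<in>D i. S i w \<noteq> {} \<and> compact (S i w)) \<and>
     (\<forall>w. T w = (\<Union>i\<in>active_indices I D w. S i w))"

definition edomain :: "('a \<Rightarrow> ereal) \<Rightarrow> 'a set" where
  "edomain V = {w. V w < \<infinity>}"

text \<open>Continuity of \<open>V\<close> in its domain is understood along the domain: whenever \<open>z\<close> tends to any
  point \<open>w\<close> of the space through points of finite value, \<open>V z\<close> tends to \<open>V w\<close>.  For \<open>w\<close> in the
  domain this is continuity of \<open>V\<close> relative to the domain.  At a boundary point \<open>w\<close> with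
  \<open>V w = \<infinity>\<close> it says that \<open>V z\<close> tends to infinity, i.e. \<open>V\<close> is lower semicontinuous there.
  With \<open>continuous_on (edomain V) V\<close> alone the iterates can have bounded finite values and
  accumulate at a point of infinite value which is not a fixed point, for instance for
  \<open>T (x, y) = {(1, y/2)}\<close> if \<open>x < 1/2\<close>, with \<open>(x, y)\<close> and \<open>(x + 1, y)\<close> (and \<open>(0, y/2)\<close> where
  \<open>x \<ge> 1\<close>, \<open>x * \<bar>y\<bar> \<ge> 1\<close>) as the values for \<open>x \<ge> 1/2\<close> (at \<open>x = 1/2\<close> also \<open>(1, y/2)\<close>), and
  \<open>V (x, y) = \<bar>y\<bar>\<close> except that \<open>V (x, 0) = \<infinity>\<close> for \<open>x < 1/2\<close>.\<close>

definition continuous_in_domain :: "('a::topological_space \<Rightarrow> ereal) \<Rightarrow> bool" where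
  "continuous_in_domain V \<longleftrightarrow> (\<forall>w. (V \<longlongrightarrow> V w) (at w within edomain V))"

definition lyapunov_function :: "('a::euclidean_space \<Rightarrow> ereal) \<Rightarrow> ('a \<Rightarrow> 'a set) \<Rightarrow> bool" where
  "lyapunov_function V T \<longleftrightarrow>
     (\<forall>w. V w \<noteq> -\<infinity>) \<and>
     continuous_in_domain V \<and>
     (INF w. V w) > -\<infinity> \<and>
     (\<forall>w. (SUP w'\<in>T w. V w') \<le> V w) \<and>
     (\<forall>w. (SUP w'\<in>T w. V w') = V w \<longrightarrow> w \<in> Fix T)"

definition calm_at ::
  "'a::real_normed_vector set \<Rightarrow> ('a \<Rightarrow> 'b::real_normed_vector set) \<Rightarrow> 'a \<Rightarrow> real \<Rightarrow> bool" where
  "calm_at X S w \<kappa> \<longleftrightarrow> w \<in> X \<and> \<kappa> \<ge> 0 \<and> S w \<noteq> {} \<and>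
     (\<exists>U. w \<in> interior U \<and>
        (\<forall>z\<in>U \<inter> X. S z \<subseteq> {u + (\<kappa> * norm (z - w)) *\<^sub>R b |u b. u \<in> S w \<and> b \<in> ball 0 1}))"

definition accumulation_point :: "(nat \<Rightarrow> 'a::topological_space) \<Rightarrow> 'a \<Rightarrow> bool" where
  "accumulation_point w p \<longleftrightarrow> (\<exists>r. strict_mono r \<and> (w \<circ> r) \<longlonglongrightarrow> p)"

definition locally_Q_linear :: "(nat \<Rightarrow> 'a::real_normed_vector) \<Rightarrow> 'a \<Rightarrow> bool" where
  "locally_Q_linear w p \<longleftrightarrow>
     (\<exists>\<kappa>\<in>{0..<1}. \<forall>\<^sub>F k in sequentially. norm (w (Suc k) - p) \<le> \<kappa> * norm (w k - p))"

end

theory Submission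
  imports Defs
begin

text \<open>Write \<open>T wstar = {p}\<close>.  Near \<open>wstar\<close> only indices active at \<open>wstar\<close> are active, so calmness
  gives \<open>norm (u - p) \<le> M * norm (z - wstar)\<close> for \<open>u \<in> T z\<close> with some \<open>M \<le> 1\<close>.  Hence along the
  subsequence converging to \<open>wstar\<close> the successors converge to \<open>p\<close>.  If \<open>V\<close> is eventually finite
  along the iterates, its monotone limit equals both \<open>V wstar\<close> and \<open>V p\<close>, so \<open>wstar\<close> is a fixed
  point.  Otherwise \<open>V\<close> is infinite along the whole sequence, each iterate is itself a fixed point,
  and the estimate at \<open>z = u = w k\<close> passes to the limit.  In both cases \<open>p = wstar\<close>, and the
  estimate says that an iterate close to \<open>wstar\<close> is never followed by a more distant one.\<close>

text \<open>The filter \<open>at p within edomain V\<close> is punctured, so indices with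
  \<open>x k = p\<close> are treated separately. The limit \<open>p\<close> itself may have infinite
  value.\<close>

lemma continuous_in_domain_LIMSEQ:
  assumes "continuous_in_domain V" and "x \<longlonglongrightarrow> p" and "\<forall>\<^sub>F k in sequentially. V (x k) < \<infinity>"
  shows "(\<lambda>k. V (x k)) \<longlonglongrightarrow> V p"
proof (rule topological_tendstoI)
  fix U assume U: "open U" "V p \<in> U"
  have "(V \<longlongrightarrow> V p) (at p within edomain V)"
    using assms(1) unfolding continuous_in_domain_def by blast
  then have "\<forall>\<^sub>F z in at p within edomain V. V z \<in> U"
    using U by (rule topological_tendstoD)
  then obtain W where W: "open W" "p \<in> W"
    and WU: "\<And>z. z \<in> W \<Longrightarrow> z \<noteq> p \<Longrightarrow> z \<in> edomain V \<Longrightarrow> V z \<in> U"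
    unfolding eventually_at_topological by blast
  have "\<forall>\<^sub>F k in sequentially. x k \<in> W"
    using assms(2) W by (rule topological_tendstoD)
  with assms(3) show "\<forall>\<^sub>F k in sequentially. V (x k) \<in> U"
  proof eventually_elim
    case (elim k)
    then show ?case using U(2) WU[of "x k"] by (cases "x k = p") (auto simp: edomain_def)
  qed
qed

lemma lyapunov_function_le:
  assumes "lyapunov_function V T" and "v \<in> T u"
  shows "V v \<le> V u"
  using assms SUP_upper[of v "T u" V] unfolding lyapunov_function_def by (meson order_trans)

text \<open>One successor with the same value as \<open>u\<close> already pushes the supremum up to
  \<open>V u\<close>. The common value may be \<open>\<infinity>\<close>.\<close>

lemma lyapunov_function_eq_imp_Fix:
  assumes L: "lyapunov_function V T" and v: "v \<in> T u" and eq: "V v = V u"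
  shows "u \<in> Fix T"
proof -
  have "(SUP v'\<in>T u. V v') \<le> V u"
    using L unfolding lyapunov_function_def by blast
  moreover have "V u \<le> (SUP v'\<in>T u. V v')"
    using SUP_upper[OF v, of V] eq by simp
  ultimately show ?thesis
    using L unfolding lyapunov_function_def by (meson antisym)
qed

text \<open>Each closed \<open>D i\<close> that misses \<open>p\<close> has a complement that is a
  neighborhood of \<open>p\<close>; finitely many of these intersect in a neighborhood.\<close>

lemma eventually_active_indices_subset:
  fixes D :: "'i \<Rightarrow> 'a::topological_space set"
  assumes "finite I" and "\<And>i. i \<in> I \<Longrightarrow> closed (D i)"
  shows "\<forall>\<^sub>F z in nhds p. active_indices I D z \<subseteq> active_indices I D p"
proof -
  have "\<forall>\<^sub>F z in nhds p. \<forall>i\<in>I. z \<in> D i \<longrightarrow> p \<in> D i"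
  proof (rule eventually_ball_finite[OF assms(1)], rule ballI)
    fix i assume "i \<in> I"
    then have op: "open (- D i)" using assms(2) by auto
    show "\<forall>\<^sub>F z in nhds p. z \<in> D i \<longrightarrow> p \<in> D i"
    proof (cases "p \<in> D i")
      case False
      then have "\<forall>\<^sub>F z in nhds p. z \<in> - D i" using op by (intro eventually_nhds_in_open) auto
      then show ?thesis by (rule eventually_mono) auto
    qed simp
  qed
  then show ?thesis by (rule eventually_mono) (auto simp: active_indices_def)
qed

text \<open>With the single center \<open>p\<close>, calmness confines \<open>S z\<close> to a ball
  about \<open>p\<close>. The weak inequality also covers radius zero.\<close>

lemma calm_at_singleton_eventually:
  assumes "calm_at X S q \<kappa>" and "S q = {p}"
  shows "\<forall>\<^sub>F z in nhds q. z \<in> X \<longrightarrow> (\<forall>u\<in>S z. norm (u - p) \<le> \<kappa> * norm (z - q))"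
proof -
  obtain U where \<kappa>: "\<kappa> \<ge> 0" and U: "q \<in> interior U" and
    sub: "\<And>z. z \<in> U \<inter> X \<Longrightarrow>
      S z \<subseteq> {u + (\<kappa> * norm (z - q)) *\<^sub>R b |u b. u \<in> S q \<and> b \<in> ball 0 1}"
    using assms(1) unfolding calm_at_def by blast
  have "\<forall>\<^sub>F z in nhds q. z \<in> interior U"
    using U by (intro eventually_nhds_in_open) auto
  then show ?thesis
  proof (rule eventually_mono, intro impI ballI)
    fix z u assume "z \<in> interior U" "z \<in> X" and u: "u \<in> S z"
    then have "z \<in> U \<inter> X" using interior_subset by blast
    from sub[OF this] u obtain b where
      b: "u = p + (\<kappa> * norm (z - q)) *\<^sub>R b" "norm b < 1"
      using assms(2) by auto
    then have "norm (u - p) = \<kappa> * norm (z - q) * norm b" using \<kappa> by simp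
    also have "\<dots> \<le> \<kappa> * norm (z - q)" using b(2) \<kappa> by (intro mult_left_le) auto
    finally show "norm (u - p) \<le> \<kappa> * norm (z - q)" .
  qed
qed

text \<open>Since \<open>T q\<close> is a singleton, all operators active at \<open>q\<close> share
  the value \<open>{p}\<close>, so their calmness estimates have a common center and merge into one
  with constant \<open>M\<close>.\<close>

lemma union_usc_calm_singleton_eventually:
  fixes q p :: "'a::euclidean_space"
  assumes T: "union_usc I D S T"
    and calm: "\<And>i. i \<in> active_indices I D q \<Longrightarrow> calm_at (D i) (S i) q (\<kappa> i)"
    and M: "\<And>i. i \<in> active_indices I D q \<Longrightarrow> \<kappa> i \<le> M"
    and p: "T q = {p}"
  shows "\<forall>\<^sub>F z in nhds q. \<forall>u\<in>T z. norm (u - p) \<le> M * norm (z - q)"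
proof -
  let ?A = "active_indices I D"
  have fin: "finite I" and clo: "\<And>i. i \<in> I \<Longrightarrow> closed (D i)"
    and Tw: "\<And>z. T z = (\<Union>i\<in>?A z. S i z)"
    using T unfolding union_usc_def by blast+
  have "\<forall>\<^sub>F z in nhds q. \<forall>i\<in>?A q. z \<in> D i \<longrightarrow> (\<forall>u\<in>S i z. norm (u - p) \<le> \<kappa> i * norm (z - q))"
  proof (rule eventually_ball_finite)
    show "finite (?A q)" using fin by (simp add: active_indices_def)
    show "\<forall>i\<in>?A q. \<forall>\<^sub>F z in nhds q.
        z \<in> D i \<longrightarrow> (\<forall>u\<in>S i z. norm (u - p) \<le> \<kappa> i * norm (z - q))"
    proof
      fix i assume i: "i \<in> ?A q"
      have "S i q \<subseteq> {p}" using Tw[of q] i p by blast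
      moreover have "S i q \<noteq> {}" using calm[OF i] unfolding calm_at_def by blast
      ultimately have "S i q = {p}" by blast
      with calm[OF i] show "\<forall>\<^sub>F z in nhds q.
          z \<in> D i \<longrightarrow> (\<forall>u\<in>S i z. norm (u - p) \<le> \<kappa> i * norm (z - q))"
        by (rule calm_at_singleton_eventually)
    qed
  qed
  moreover have "\<forall>\<^sub>F z in nhds q. ?A z \<subseteq> ?A q"
    using fin clo by (rule eventually_active_indices_subset)
  ultimately show ?thesis
  proof eventually_elim
    case (elim z)
    show ?case
    proof
      fix u assume "u \<in> T z"
      then obtain i where i: "i \<in> ?A z" "u \<in> S i z" using Tw by blast
      then have iq: "i \<in> ?A q" using elim(2) by blast
      then have "norm (u - p) \<le> \<kappa> i * norm (z - q)"
        using elim(1) i unfolding active_indices_def by blast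
      also have "\<dots> \<le> M * norm (z - q)" using M[OF iq] by (intro mult_right_mono) auto
      finally show "norm (u - p) \<le> M * norm (z - q)" .
    qed
  qed
qed

lemma accumulation_point_fixed:
  fixes T :: "'a::euclidean_space \<Rightarrow> 'a set"
  assumes L: "lyapunov_function V T"
    and step: "\<And>k. w (Suc k) \<in> T (w k)"
    and r: "strict_mono r" "(w \<circ> r) \<longlonglongrightarrow> q"
    and p: "T q = {p}"
    and near: "\<forall>\<^sub>F z in nhds q. \<forall>u\<in>T z. norm (u - p) \<le> norm (z - q)"
  shows "p = q"
proof -
  have wr: "(\<lambda>k. w (r k)) \<longlonglongrightarrow> q" using r(2) by (simp add: o_def)
  have ev: "\<forall>\<^sub>F k in sequentially. \<forall>u\<in>T (w (r k)). norm (u - p) \<le> norm (w (r k) - q)"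
    using near wr by (rule eventually_compose_filterlim)
  have "(\<lambda>k. w (r k) - q) \<longlonglongrightarrow> 0" using wr by (simp add: LIM_zero)
  \<comment> \<open>Stated for an arbitrary selection \<open>x\<close>, because it serves both for
    the successors \<open>w (Suc (r k))\<close> and, in the infinite case, for
    \<open>w (r k)\<close> itself.\<close>
  then have lim: "x \<longlonglongrightarrow> p" if "\<And>k. x k \<in> T (w (r k))" for x
  proof -
    have "(\<lambda>k. x k - p) \<longlonglongrightarrow> 0"
      using \<open>(\<lambda>k. w (r k) - q) \<longlonglongrightarrow> 0\<close>
      by (rule Lim_transform_bound[rotated]) (use ev that in \<open>auto elim: eventually_mono\<close>)
    then show ?thesis by (simp add: LIM_zero_iff)
  qed
  show ?thesis
  proof (cases "\<exists>N. V (w N) < \<infinity>")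
    case True
    then obtain N where N: "V (w N) < \<infinity>" by blast
    have dec: "decseq (\<lambda>k. V (w k))"
      using lyapunov_function_le[OF L step] by (rule decseq_SucI)
    have fin: "V (w k) < \<infinity>" if "N \<le> k" for k
      using decseqD[OF dec that] N by (rule le_less_trans)
    have "N \<le> r k" if "N \<le> k" for k using that seq_suble[OF r(1), of k] by simp
    then have fin_r: "\<forall>\<^sub>F k in sequentially. V (w (r k)) < \<infinity>"
      and fin_Suc: "\<forall>\<^sub>F k in sequentially. V (w (Suc (r k))) < \<infinity>"
      unfolding eventually_sequentially by (meson fin le_SucI)+
    have VL: "(\<lambda>k. V (w k)) \<longlonglongrightarrow> (INF k. V (w k))" using dec by (rule LIMSEQ_INF)
    \<comment> \<open>The successors also form a subsequence, so \<open>V q\<close> and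
      \<open>V p\<close> are limits along two subsequences of one convergent sequence.\<close>
    have mono': "strict_mono (\<lambda>k. Suc (r k))" using r(1) by (simp add: strict_mono_def)
    have c: "continuous_in_domain V" using L unfolding lyapunov_function_def by blast
    have "(\<lambda>k. V (w (r k))) \<longlonglongrightarrow> V q"
      using c wr fin_r by (rule continuous_in_domain_LIMSEQ)
    with LIMSEQ_subseq_LIMSEQ[OF VL r(1)] have "V q = (INF k. V (w k))"
      by (auto simp: o_def intro: LIMSEQ_unique)
    moreover have "(\<lambda>k. V (w (Suc (r k)))) \<longlonglongrightarrow> V p"
      using c lim[OF step] fin_Suc by (rule continuous_in_domain_LIMSEQ)
    with LIMSEQ_subseq_LIMSEQ[OF VL mono'] have "V p = (INF k. V (w k))"
      by (auto simp: o_def intro: LIMSEQ_unique)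
    ultimately have "q \<in> Fix T"
      using p by (intro lyapunov_function_eq_imp_Fix[OF L, of p]) auto
    then show ?thesis using p by (simp add: Fix_def)
  next
    case False
    then have "V (w k) = \<infinity>" for k by auto
    \<comment> \<open>Consecutive values are both \<open>\<infinity>\<close>, hence equal.\<close>
    then have "w k \<in> Fix T" for k
      using lyapunov_function_eq_imp_Fix[OF L step] by simp
    then have "(\<lambda>k. w (r k)) \<longlonglongrightarrow> p" by (intro lim) (simp add: Fix_def)
    then show ?thesis using wr by (rule LIMSEQ_unique)
  qed
qed

text \<open>A single entry into a small ball about \<open>q\<close> suffices: from then on the
  distance to \<open>q\<close> cannot grow, so the sequence stays in the ball.\<close>

lemma accumulation_point_LIMSEQ:
  fixes w :: "nat \<Rightarrow> 'a::real_normed_vector"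
  assumes r: "(w \<circ> r) \<longlonglongrightarrow> q"
    and step: "\<And>k. w (Suc k) \<in> T (w k)"
    and near: "\<forall>\<^sub>F z in nhds q. \<forall>u\<in>T z. norm (u - q) \<le> norm (z - q)"
  shows "w \<longlonglongrightarrow> q"
proof (rule metric_LIMSEQ_I)
  fix e :: real assume "e > 0"
  obtain d where d: "d > 0"
    "\<And>z u. dist z q < d \<Longrightarrow> u \<in> T z \<Longrightarrow> norm (u - q) \<le> norm (z - q)"
    using near unfolding eventually_nhds_metric by blast
  \<comment> \<open>Radius \<open>d\<close> keeps the estimate applicable at every later iterate;
    \<open>e\<close> is the target accuracy.\<close>
  obtain m where "dist ((w \<circ> r) m) q < min d e"
    using metric_LIMSEQ_D[OF r, of "min d e"] \<open>d > 0\<close> \<open>e > 0\<close> by auto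
  then have m: "dist (w (r m)) q < min d e" by simp
  have "dist (w k) q < min d e" if "r m \<le> k" for k
    using that
  proof (induction k rule: dec_induct)
    case (step k)
    then show ?case
      using d(2)[of "w k" "w (Suc k)"] assms(2)[of k] by (simp add: dist_norm)
  qed (rule m)
  then show "\<exists>N. \<forall>k\<ge>N. dist (w k) q < e" by auto
qed

theorem theorem4p4:
  fixes T :: "'a::euclidean_space \<Rightarrow> 'a set"
    and I :: "'i set" and D :: "'i \<Rightarrow> 'a set" and S :: "'i \<Rightarrow> 'a \<Rightarrow> 'a set"
    and w :: "nat \<Rightarrow> 'a" and wstar :: 'a and \<kappa> :: "'i \<Rightarrow> real"
  assumes "union_usc I D S T"
    and "\<exists>V. lyapunov_function V T"
    and "\<And>k. w (Suc k) \<in> T (w k)"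
    and "accumulation_point w wstar"
    and "\<And>i. i \<in> active_indices I D wstar \<Longrightarrow> \<kappa> i \<in> {0..1} \<and> calm_at (D i) (S i) wstar (\<kappa> i)"
    and "is_singleton (T wstar)"
  shows "w \<longlonglongrightarrow> wstar
    \<and> (\<forall>\<^sub>F k in sequentially. active_indices I D (w k) \<subseteq> active_indices I D wstar)
    \<and> ((\<forall>i\<in>active_indices I D wstar. \<kappa> i < 1) \<longrightarrow> locally_Q_linear w wstar)"
proof -
  let ?A = "active_indices I D"
  obtain V where V: "lyapunov_function V T" using assms(2) by blast
  obtain p where p: "T wstar = {p}" using assms(6) by (rule is_singletonE)
  obtain r where r: "strict_mono r" "(w \<circ> r) \<longlonglongrightarrow> wstar"
    using assms(4) unfolding accumulation_point_def by blast
  have fin: "finite I" and clo: "\<And>i. i \<in> I \<Longrightarrow> closed (D i)"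
    using assms(1) unfolding union_usc_def by blast+
  \<comment> \<open>The constant is left open: \<open>M = 1\<close> yields convergence, and the
    largest calmness parameter yields the rate.\<close>
  have bound: "\<forall>\<^sub>F z in nhds wstar. \<forall>u\<in>T z. norm (u - p) \<le> M * norm (z - wstar)"
    if "\<And>i. i \<in> ?A wstar \<Longrightarrow> \<kappa> i \<le> M" for M
    using assms(1,5) that p by (intro union_usc_calm_singleton_eventually[where \<kappa> = \<kappa>]) auto
  have near: "\<forall>\<^sub>F z in nhds wstar. \<forall>u\<in>T z. norm (u - p) \<le> norm (z - wstar)"
    using bound[of 1] assms(5) by auto
  have pw: "p = wstar"
    using V assms(3) r p near by (rule accumulation_point_fixed)
  have conv: "w \<longlonglongrightarrow> wstar"
    using r(2) assms(3) near[unfolded pw] by (rule accumulation_point_LIMSEQ)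
  have "\<forall>\<^sub>F k in sequentially. ?A (w k) \<subseteq> ?A wstar"
    using eventually_active_indices_subset[of I D, OF fin clo] conv
    by (rule eventually_compose_filterlim)
  moreover have "locally_Q_linear w wstar" if lt: "\<forall>i\<in>?A wstar. \<kappa> i < 1"
  proof -
    \<comment> \<open>inserting \<open>0\<close> keeps \<open>Max\<close> off the empty set and makes \<open>?M\<close> nonnegative\<close>
    let ?B = "insert 0 (\<kappa> ` ?A wstar)" and ?M = "Max (insert 0 (\<kappa> ` ?A wstar))"
    have B: "finite ?B" using fin by (simp add: active_indices_def)
    have "\<kappa> i \<le> ?M" if "i \<in> ?A wstar" for i using B that by (intro Max_ge) auto
    from eventually_compose_filterlim[OF bound[OF this] conv]
    have "\<forall>\<^sub>F k in sequentially. norm (w (Suc k) - wstar) \<le> ?M * norm (w k - wstar)"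
      by (rule eventually_mono) (use assms(3) in \<open>auto simp: pw\<close>)
    moreover have "0 \<le> ?M" using B by (intro Max_ge) auto
    \<comment> \<open>Only finitely many indices are active, so the strict bounds survive taking the
      maximum.\<close>
    moreover have "?M < 1" using B lt by (subst Max_less_iff) auto
    ultimately show ?thesis unfolding locally_Q_linear_def by (meson atLeastLessThan_iff)
  qed
  ultimately show ?thesis using conv by blast
qed

end
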